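(* Let $\mathcal{F}$ be a convex class of distribution functions on $\mathsf{O}\subseteq\mathbb{R}^d$. Let $T\colon\mathcal{F}\to\mathsf{A}\subseteq\mathbb{R}^k$ be a surjective, elicitable and identifiable functional with a strict $\mathcal{F}$-identification function $V\colon\mathsf{A}\times\mathsf{O}\to\mathbb{R}^k$ and a strictly $\mathcal{F}$-consistent scoring function $S\colon\mathsf{A}\times\mathsf{O}\to\mathbb{R}$. Assume that (a) for every $x\in\operatorname{int}(\mathsf{A})$ there are $F_1,\dots,F_{k+1}\in\mathcal{F}$ such that $0\in\operatorname{int}\big(\operatorname{conv}(\{\bar V(x,F_1),\dots,\bar V(x,F_{k+1})\})\big)$; and (b) for every $F\in\mathcal{F}$ the function $\bar S(\cdot,F)\colon\mathsf{A}\to\mathbb{R}$ is continuously differentiable. Then there exists a matrix-valued function $h\colon\operatorname{int}(\mathsf{A})\to\mathbb{R}^{k\times k}$ such that for every $l\in\{1,\dots,k\}$ $$\partial_l\bar S(x,F)=\sum_{m=1}^k h_{lm}(x)\,\bar V_m(x,F)\qquad\text{for all }x\in\operatorname{int}(\mathsf{A})\text{ and }F\in\mathcal{F}.$$ If in addition, for every $F\in\mathcal{F}$, the function $\bar V(\cdot,F)\colon\mathsf{A}\to\mathbb{R}^k$ is continuous, then $h$ is continuous. If, additionally, for every $F\in\mathcal{F}$ the function $\bar V(\cdot,F)$ is continuously differentiable, and for every $F\in\mathcal{F}$ the function $\bar S(\cdot,F)$ is continuously differentiable with locally Lipschitz continuous gradient and is twice continuously differentiable at $t=T(F)$ whenever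 $T(F)\in\operatorname{int}(\mathsf{A})$, then $h$ is locally Lipschitz continuous.
   Context: $d,k\ge1$ are integers, $\mathsf{O}\subseteq\mathbb{R}^d$ carries its Borel $\sigma$-algebra, $\mathsf{A}\subseteq\mathbb{R}^k$, and $\mathcal{F}$ is a class of Borel probability measures on $\mathsf{O}$, identified with their cumulative distribution functions. A function $a\colon\mathsf{O}\to\mathbb{R}$ is $\mathcal{F}$-integrable if it is $F$-integrable for each $F\in\mathcal{F}$; a function $g$ on $\mathsf{A}\times\mathsf{O}$ is $\mathcal{F}$-integrable if $g(x,\cdot)$ is $\mathcal{F}$-integrable for each $x\in\mathsf{A}$, and then $\bar g(x,F):=\int g(x,y)\,\mathrm{d}F(y)$ (componentwise if $g$ is vector-valued). A functional is a map $T\colon\mathcal{F}\to\mathsf{A}$. A scoring function is an $\mathcal{F}$-integrable function $S\colon\mathsf{A}\times\mathsf{O}\to\mathbb{R}$; it is strictly $\mathcal{F}$-consistent for $T$ if $\bar S(T(F),F)\le\bar S(x,F)$ for all $F\in\mathcal{F}$, $x\in\mathsf{A}$, with equality only if $x=T(F)$. $T$ is elicitable if a strictly $\mathcal{F}$-consistent scoring function for it exists. A strict $\mathcal{F}$-identification function for $T$ is an $\mathcal{F}$-integrable $V\colon\mathsf{A}\times\mathsf{O}\to\mathbb{R}^k$ such that for all $F\in\mathcal{F}$, $x\in\mathsf{A}$: $\bar V(x,F)=0$ if and only if $x=T(F)$. $T$ is identifiable if such a $V$ exists. $\operatorname{int}$ denotes the interior in $\mathbb{R}^k$, $\operatorname{conv}$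 the convex hull, and $\partial_l$ the partial derivative with respect to the $l$-th component of $x$. Differentiability properties of a function on $\mathsf{A}$ are understood on $\operatorname{int}(\mathsf{A})$. *)

theory Defs
  imports "HOL-Probability.Probability"
begin

text \<open>Distribution functions are identified with the probability measures they determine, so a class
  of distribution functions on \<open>\<O>\<close> is a set of measures on the Borel sets of the subspace \<open>\<O>\<close>.\<close>

definition borel_prob_measures :: "'a::topological_space set \<Rightarrow> 'a measure set" where
  "borel_prob_measures \<O> = {F. prob_space F \<and> sets F = sets (restrict_space borel \<O>)}"

text \<open>The mixture \<open>H\<close> is determined uniquely by its values on the common \<open>\<sigma>\<close>-algebra.\<close>

definition convex_class :: "'a measure set \<Rightarrow> bool" where
  "convex_class \<F> \<longleftrightarrow>
     (\<forall>F\<in>\<F>. \<forall>G\<in>\<F>. \<forall>t\<in>{0..1::real}. \<exists>H\<in>\<F>.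
        \<forall>B\<in>sets F. measure H B = (1 - t) * measure F B + t * measure G B)"

definition class_integrable ::
  "'x set \<Rightarrow> 'a measure set \<Rightarrow> ('x \<Rightarrow> 'a \<Rightarrow> 'b::{banach, second_countable_topology}) \<Rightarrow> bool" where
  "class_integrable A \<F> g \<longleftrightarrow> (\<forall>x\<in>A. \<forall>F\<in>\<F>. integrable F (g x))"

definition expect ::
  "('x \<Rightarrow> 'a \<Rightarrow> 'b::{banach, second_countable_topology}) \<Rightarrow> 'x \<Rightarrow> 'a measure \<Rightarrow> 'b" where
  "expect g x F = (LINT y|F. g x y)"

definition strictly_consistent ::
  "'x set \<Rightarrow> 'a measure set \<Rightarrow> ('a measure \<Rightarrow> 'x) \<Rightarrow> ('x \<Rightarrow> 'a \<Rightarrow> real) \<Rightarrow> bool" where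
  "strictly_consistent A \<F> T S \<longleftrightarrow>
     class_integrable A \<F> S \<and>
     (\<forall>F\<in>\<F>. \<forall>x\<in>A. expect S (T F) F \<le> expect S x F \<and>
        (expect S (T F) F = expect S x F \<longrightarrow> x = T F))"

definition strict_identification ::
  "(real ^ 'k) set \<Rightarrow> 'a measure set \<Rightarrow> ('a measure \<Rightarrow> real ^ 'k) \<Rightarrow>
    (real ^ 'k \<Rightarrow> 'a \<Rightarrow> real ^ 'k) \<Rightarrow> bool" where
  "strict_identification A \<F> T V \<longleftrightarrow>
     class_integrable A \<F> V \<and>
     (\<forall>F\<in>\<F>. \<forall>x\<in>A. expect V x F = 0 \<longleftrightarrow> x = T F)"

definition partial_deriv :: "'k \<Rightarrow> (real ^ 'k \<Rightarrow> real) \<Rightarrow> real ^ 'k::finite \<Rightarrow> real" where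
  "partial_deriv l f x = deriv (\<lambda>t. f (x + t *\<^sub>R axis l 1)) 0"

definition cont_differentiable_on ::
  "'a::real_normed_vector set \<Rightarrow> ('a \<Rightarrow> 'b::real_normed_vector) \<Rightarrow> bool" where
  "cont_differentiable_on U f \<longleftrightarrow>
     (\<exists>f'. (\<forall>x\<in>U. (f has_derivative blinfun_apply (f' x)) (at x)) \<and> continuous_on U f')"

text \<open>The derivatives up to order two are required to exist near \<open>t\<close>, but the second derivative
  need only be continuous at \<open>t\<close> itself.\<close>

definition twice_cont_differentiable_at ::
  "('a::real_normed_vector \<Rightarrow> 'b::real_normed_vector) \<Rightarrow> 'a \<Rightarrow> bool" where
  "twice_cont_differentiable_at f t \<longleftrightarrow>
     (\<exists>N f' f''. open N \<and> t \<in> N \<and>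
        (\<forall>x\<in>N. (f has_derivative blinfun_apply (f' x)) (at x)) \<and>
        (\<forall>x\<in>N. (f' has_derivative blinfun_apply (f'' x)) (at x)) \<and>
        isCont f'' t)"

definition locally_lipschitz_on ::
  "'a::metric_space set \<Rightarrow> ('a \<Rightarrow> 'b::metric_space) \<Rightarrow> bool" where
  "locally_lipschitz_on U f \<longleftrightarrow> (\<forall>x\<in>U. \<exists>e>0. \<exists>L. L-lipschitz_on (ball x e \<inter> U) f)"

definition locally_lipschitz_gradient_on ::
  "'a::real_inner set \<Rightarrow> ('a \<Rightarrow> real) \<Rightarrow> bool" where
  "locally_lipschitz_gradient_on U f \<longleftrightarrow>
     (\<exists>g. (\<forall>x\<in>U. GDERIV f x :> g x) \<and> locally_lipschitz_on U g)"

end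

theory Submission
  imports Defs
begin

text \<open>For fixed \<open>x\<close>, the expected identification function \<open>W F\<close> and the partial derivatives \<open>p F\<close>
  of the expected score respect mixtures of distributions, and \<open>W F = 0\<close> forces \<open>x = T F\<close>, where
  the expected score is minimal, hence \<open>p F = 0\<close>. As \<open>0\<close> is interior to the set of values of \<open>W\<close>,
  this makes \<open>p\<close> a linear function of \<open>W\<close>, say \<open>p F = q x \<bullet> W F\<close>. For the regularity of \<open>q\<close>, the
  finitely many distributions of assumption (a) give \<open>c * norm a \<le> (\<Sum>i. \<bar>a \<bullet> W (F i)\<bar>)\<close> for all
  \<open>a\<close>, locally uniformly in \<open>x\<close>; applied to \<open>a = q x - q y\<close>, this bounds the increments of \<open>q\<close> by
  those of \<open>W\<close> and \<open>p\<close>.\<close>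

section \<open>Integration against mixtures of measures\<close>

text \<open>The hypothesis \<open>mix\<close> is the case of indicator functions. Both sides respect
  scaling, sums and increasing limits, so induction over measurable functions does the rest.\<close>

lemma nn_integral_mixture:
  fixes F G H :: "'a measure"
  assumes sets: "sets G = sets F" "sets H = sets F"
    and mix: "\<And>B. B \<in> sets F \<Longrightarrow> emeasure H B = a * emeasure F B + b * emeasure G B"
    and f: "f \<in> borel_measurable F"
  shows "(\<integral>\<^sup>+y. f y \<partial>H) = a * (\<integral>\<^sup>+y. f y \<partial>F) + b * (\<integral>\<^sup>+y. f y \<partial>G)"
  using f
proof (induction rule: borel_measurable_induct)
  case (cong f g)
  have "space G = space F" "space H = space F"
    using sets by (auto dest: sets_eq_imp_space_eq)
  then have "(\<integral>\<^sup>+y. f y \<partial>M) = (\<integral>\<^sup>+y. g y \<partial>M)" if "M \<in> {F, G, H}" for M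
    using that cong by (intro nn_integral_cong) auto
  then show ?case using cong by simp
next
  case (set B)
  then show ?case using sets mix by simp
next
  case (mult u c)
  moreover have "u \<in> borel_measurable G" "u \<in> borel_measurable H"
    using mult sets by (auto cong: measurable_cong_sets)
  ultimately show ?case by (simp add: nn_integral_cmult algebra_simps)
next
  case (add u v)
  moreover have "u \<in> borel_measurable G" "u \<in> borel_measurable H"
      "v \<in> borel_measurable G" "v \<in> borel_measurable H"
    using add sets by (auto cong: measurable_cong_sets)
  ultimately show ?case by (simp add: nn_integral_add algebra_simps)
next
  case (seq U)
  have meas: "U i \<in> borel_measurable M" if "M \<in> {F, G, H}" for i M
    using that seq.hyps(1)[of i] sets by (auto cong: measurable_cong_sets)
  have sup: "(\<integral>\<^sup>+y. (SUP i. U i) y \<partial>M) = (SUP i. \<integral>\<^sup>+y. U i y \<partial>M)" if "M \<in> {F, G, H}" for M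
    using nn_integral_monotone_convergence_SUP[OF seq.hyps(3) meas[OF that]]
    by (simp add: image_image)
  \<comment> \<open>The supremum of a sum splits into the sum of the suprema only because both
    sequences increase.\<close>
  have inc: "incseq (\<lambda>i. k * (\<integral>\<^sup>+y. U i y \<partial>M))" for k M
    using seq.hyps(3) by (auto simp: mono_def le_fun_def intro!: mult_left_mono nn_integral_mono)
  show ?case
    by (simp only: sup insert_iff simp_thms seq.IH SUP_mult_left_ennreal ennreal_SUP_add[OF inc inc])
qed

text \<open>Non-negative integrands reduce to the previous lemma, as integrability makes all
  integrals finite and so lets \<open>ennreal\<close> be cancelled. The general case is the
  difference of positive and negative part.\<close>

lemma integral_mixture_real:
  fixes f :: "'a \<Rightarrow> real"
  assumes prob: "finite_measure F" "finite_measure G" "finite_measure H"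
    and sets: "sets G = sets F" "sets H = sets F"
    and t: "0 \<le> t" "t \<le> 1"
    and mix: "\<And>B. B \<in> sets F \<Longrightarrow> measure H B = (1 - t) * measure F B + t * measure G B"
    and int: "integrable F f" "integrable G f" "integrable H f"
  shows "(LINT y|H. f y) = (1 - t) * (LINT y|F. f y) + t * (LINT y|G. f y)"
proof -
  \<comment> \<open>\<open>ennreal\<close> respects sums and products only of non-negative reals;
    this is where both bounds on \<open>t\<close> enter.\<close>
  have emix: "emeasure H B = ennreal (1 - t) * emeasure F B + ennreal t * emeasure G B"
    if "B \<in> sets F" for B
    using prob t mix[OF that]
    by (simp add: finite_measure.emeasure_eq_measure ennreal_plus flip: ennreal_mult)
  have nonneg: "(LINT y|H. g y) = (1 - t) * (LINT y|F. g y) + t * (LINT y|G. g y)"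
    if g: "integrable F g" "integrable G g" "integrable H g" "\<And>y. 0 \<le> g y" for g :: "'a \<Rightarrow> real"
  proof -
    have "ennreal (LINT y|H. g y) = (\<integral>\<^sup>+y. g y \<partial>H)"
      using g by (simp add: nn_integral_eq_integral)
    also have "\<dots> = ennreal (1 - t) * (\<integral>\<^sup>+y. g y \<partial>F) + ennreal t * (\<integral>\<^sup>+y. g y \<partial>G)"
      using g(1) by (intro nn_integral_mixture[OF sets emix]) auto
    also have "\<dots> = ennreal ((1 - t) * (LINT y|F. g y) + t * (LINT y|G. g y))"
      using g t by (simp add: nn_integral_eq_integral ennreal_plus flip: ennreal_mult)
    finally show ?thesis
      using t g(4) by (subst (asm) ennreal_inj) (auto intro!: add_nonneg_nonneg mult_nonneg_nonneg)
  qed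
  have split: "(LINT y|M. f y) = (LINT y|M. max 0 (f y)) - (LINT y|M. max 0 (- f y))"
    if "integrable M f" for M
  proof -
    have "(LINT y|M. f y) = (LINT y|M. max 0 (f y) - max 0 (- f y))"
      by (intro Bochner_Integration.integral_cong) auto
    then show ?thesis using that by simp
  qed
  show ?thesis
    using nonneg[of "\<lambda>y. max 0 (f y)"] nonneg[of "\<lambda>y. max 0 (- f y)"] int
    by (simp add: split algebra_simps)
qed

lemma integral_mixture:
  fixes f :: "'a \<Rightarrow> 'b::euclidean_space"
  assumes prob: "finite_measure F" "finite_measure G" "finite_measure H"
    and sets: "sets G = sets F" "sets H = sets F"
    and t: "0 \<le> t" "t \<le> 1"
    and mix: "\<And>B. B \<in> sets F \<Longrightarrow> measure H B = (1 - t) * measure F B + t * measure G B"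
    and int: "integrable F f" "integrable G f" "integrable H f"
  shows "(LINT y|H. f y) = (1 - t) *\<^sub>R (LINT y|F. f y) + t *\<^sub>R (LINT y|G. f y)"
proof (rule euclidean_eqI)
  fix b :: 'b
  have "integrable M (\<lambda>y. f y \<bullet> b)" if "M \<in> {F, G, H}" for M
    using that int by auto
  from integral_mixture_real[OF prob sets t mix this this this]
  show "(LINT y|H. f y) \<bullet> b = ((1 - t) *\<^sub>R (LINT y|F. f y) + t *\<^sub>R (LINT y|G. f y)) \<bullet> b"
    using int by (simp add: inner_add_left)
qed

section \<open>Convex sets that are graphs of linear functions\<close>

text \<open>By \<open>zero\<close>, the convex set \<open>C\<close> misses the ray of points \<open>(0, s)\<close> with \<open>s > 0\<close>. A hyperplane
  separating them passes through the origin and is not vertical; since every point of \<open>C\<close> is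
  balanced by another one on the opposite side of the \<open>s\<close>-axis, it contains all of \<open>C\<close>.\<close>

lemma convex_graph_imp_linear:
  fixes C :: "('a::euclidean_space \<times> real) set"
  assumes conv: "convex C"
    and zero: "\<And>s. (0, s) \<in> C \<Longrightarrow> s = 0"
    and int: "0 \<in> interior (fst ` C)"
  shows "\<exists>q. \<forall>(w, s)\<in>C. s = q \<bullet> w"
proof -
  obtain e where e: "e > 0" "cball 0 e \<subseteq> fst ` C"
    using int by (auto simp: mem_interior_cball)
  have lift: "\<exists>s. (w, s) \<in> C" if "norm w \<le> e" for w
    using e that by (force simp: subset_iff)
  have origin: "(0, 0) \<in> C"
    using lift[of 0] zero e by auto
  define R where "R = {0::'a} \<times> {0::real<..}"
  have "convex R" unfolding R_def by (intro convex_Times) auto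
  moreover have "R \<noteq> {}" by (auto simp: R_def intro: exI[of _ "1::real"])
  moreover have "C \<inter> R = {}" using zero by (auto simp: R_def)
  ultimately obtain ab b where ab: "ab \<noteq> 0" "\<And>x. x \<in> C \<Longrightarrow> ab \<bullet> x \<le> b" "\<And>x. x \<in> R \<Longrightarrow> ab \<bullet> x \<ge> b"
    using separating_hyperplane_sets[of C R] conv origin by blast
  obtain \<alpha> \<beta> where [simp]: "ab = (\<alpha>, \<beta>)" by (cases ab)
  have "b \<ge> 0" using ab(2)[OF origin] by simp
  have ray: "b \<le> \<beta> * s" if "s > 0" for s using ab(3)[of "(0, s)"] that by (simp add: R_def)
  have \<beta>: "\<beta> \<ge> 0" using ray[of 1] \<open>b \<ge> 0\<close> by simp
  \<comment> \<open>Let \<open>s\<close> tend to 0 in \<open>ray\<close>. The denominator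
    \<open>\<beta> + 1\<close> serves the case \<open>\<beta> = 0\<close> as well.\<close>
  have "b \<le> 0"
  proof (rule field_le_epsilon)
    fix d :: real assume "d > 0"
    then have "b \<le> \<beta> * (d / (\<beta> + 1))" using \<beta> by (intro ray) simp
    also have "\<dots> \<le> d" using \<open>d > 0\<close> \<beta> by (simp add: field_simps)
    finally show "b \<le> 0 + d" by simp
  qed
  then have le: "\<alpha> \<bullet> w + \<beta> * s \<le> 0" if "(w, s) \<in> C" for w s
    using ab(2)[OF that] \<open>b \<ge> 0\<close> by simp
  \<comment> \<open>A vertical hyperplane would confine the projection of \<open>C\<close> to the
    half-space \<open>\<alpha> \<bullet> w \<le> 0\<close>, yet that projection contains a ball
    around 0.\<close>
  have "\<beta> \<noteq> 0"
  proof
    assume "\<beta> = 0"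
    then have "\<alpha> \<noteq> 0" using ab(1) by (simp add: zero_prod_def)
    define w where "w = (e / norm \<alpha>) *\<^sub>R \<alpha>"
    have "norm w = e" using \<open>\<alpha> \<noteq> 0\<close> e by (simp add: w_def)
    then obtain s where "(w, s) \<in> C" using lift by fastforce
    from le[OF this] \<open>\<beta> = 0\<close> have "\<alpha> \<bullet> w \<le> 0" by simp
    moreover have "\<alpha> \<bullet> w > 0" using \<open>\<alpha> \<noteq> 0\<close> e by (simp add: w_def)
    ultimately show False by simp
  qed
  have "\<alpha> \<bullet> w + \<beta> * s = 0" if ws: "(w, s) \<in> C" for w s
  proof -
    \<comment> \<open>The factor is small enough for \<open>- r *\<^sub>R w\<close> to lie in the
      ball over which \<open>C\<close> has points, and positive even if \<open>w = 0\<close>. The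
      weights \<open>1 / (1 + r)\<close> and \<open>r / (1 + r)\<close> then cancel the first
      components, so \<open>zero\<close> forces \<open>z = - r * s\<close>, and \<open>le\<close> at
      the balancing point is the reverse inequality at \<open>(w, s)\<close>.\<close>
    define r where "r = e / (norm w + 1)"
    have r: "r > 0" "norm (- r *\<^sub>R w) \<le> e"
      using e by (auto simp: r_def field_simps add_pos_nonneg mult_left_mono)
    then obtain z where z: "(- r *\<^sub>R w, z) \<in> C" using lift by blast
    have "(1 / (1 + r)) *\<^sub>R (- r *\<^sub>R w, z) + (r / (1 + r)) *\<^sub>R (w, s) \<in> C"
      using r by (intro convexD[OF conv z ws]) (auto simp: field_simps)
    then have "(0, (z + r * s) / (1 + r)) \<in> C"
      by (simp add: add_divide_distrib)
    from zero[OF this] have "z = - r * s" using r by simp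
    with le[OF z] have "0 \<le> r * (\<alpha> \<bullet> w + \<beta> * s)" by (simp add: algebra_simps)
    with r have "\<alpha> \<bullet> w + \<beta> * s \<ge> 0" by (simp add: zero_le_mult_iff)
    with le[OF ws] show ?thesis by simp
  qed
  then have "s = (- (1 / \<beta>) *\<^sub>R \<alpha>) \<bullet> w" if "(w, s) \<in> C" for w s
    using that \<open>\<beta> \<noteq> 0\<close> by (force simp: field_simps eq_neg_iff_add_eq_0)
  then show ?thesis by blast
qed

section \<open>Regularity of the coefficient in a linear representation\<close>

text \<open>The linear function \<open>v \<mapsto> a \<bullet> v\<close> takes the value
  \<open>r * norm a\<close> at the point of the ball in direction \<open>a\<close>, while on the
  hull it cannot exceed its largest value at a generator. The sum of absolute values dominates that
  maximum.\<close>

lemma norm_le_sum_abs_inner: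
  fixes w :: "'i \<Rightarrow> 'a::real_inner"
  assumes I: "finite I" and r: "r \<ge> 0" "cball 0 r \<subseteq> convex hull (w ` I)"
  shows "r * norm a \<le> (\<Sum>i\<in>I. \<bar>a \<bullet> w i\<bar>)"
proof (cases "a = 0")
  case False
  have "convex hull (w ` I) \<subseteq> {v. a \<bullet> v \<le> (\<Sum>i\<in>I. \<bar>a \<bullet> w i\<bar>)}"
  proof (rule hull_minimal)
    have "a \<bullet> w i \<le> (\<Sum>i\<in>I. \<bar>a \<bullet> w i\<bar>)" if "i \<in> I" for i
      using member_le_sum[of i I "\<lambda>i. \<bar>a \<bullet> w i\<bar>"] that I by simp
    then show "w ` I \<subseteq> {v. a \<bullet> v \<le> (\<Sum>i\<in>I. \<bar>a \<bullet> w i\<bar>)}" by auto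
  qed (rule convex_halfspace_le)
  moreover have "(r / norm a) *\<^sub>R a \<in> cball 0 r" using False r by simp
  ultimately have "a \<bullet> ((r / norm a) *\<^sub>R a) \<le> (\<Sum>i\<in>I. \<bar>a \<bullet> w i\<bar>)" using r by blast
  then show ?thesis using False by (simp add: power2_norm_eq_inner[symmetric] power2_eq_square)
qed (simp add: sum_nonneg)

text \<open>Moving from \<open>x\<close> to \<open>y\<close> changes the sum by at most
  \<open>norm a * D y\<close>, by Cauchy-Schwarz. Where \<open>D y < r / 2\<close>, half of the
  constant at \<open>x\<close> survives, uniformly in \<open>a\<close>.\<close>

lemma norm_le_sum_abs_inner_locally:
  fixes W :: "'i \<Rightarrow> 'x::real_normed_vector \<Rightarrow> 'a::real_inner"
  assumes I: "finite I" and int: "0 \<in> interior (convex hull ((\<lambda>i. W i x) ` I))"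
    and cont: "\<And>i. i \<in> I \<Longrightarrow> isCont (W i) x"
  shows "\<exists>c>0. \<exists>e>0. \<forall>y\<in>ball x e. \<forall>a. c * norm a \<le> (\<Sum>i\<in>I. \<bar>a \<bullet> W i y\<bar>)"
proof -
  obtain r where r: "r > 0" "cball 0 r \<subseteq> convex hull ((\<lambda>i. W i x) ` I)"
    using int by (auto simp: mem_interior_cball)
  define D where "D y = (\<Sum>i\<in>I. norm (W i y - W i x))" for y
  have "isCont D x" unfolding D_def using cont by (intro continuous_intros)
  then have "(D \<longlongrightarrow> D x) (at x)" by (simp add: isCont_def)
  \<comment> \<open>\<open>D x\<close> vanishes. The fact is used twice: as the strict bound on the
    limit, and to add the centre, which the punctured filter \<open>at x\<close> omits.\<close>
  moreover have "D x < r / 2" using r by (simp add: D_def)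
  ultimately have "eventually (\<lambda>y. D y < r / 2) (at x)" by (rule order_tendstoD)
  with \<open>D x < r / 2\<close> have "eventually (\<lambda>y. D y < r / 2) (nhds x)"
    by (simp add: eventually_nhds_conv_at)
  then obtain e where e: "e > 0" "\<And>y. dist y x < e \<Longrightarrow> D y < r / 2"
    by (auto simp: eventually_nhds_metric)
  have "r / 2 * norm a \<le> (\<Sum>i\<in>I. \<bar>a \<bullet> W i y\<bar>)" if y: "y \<in> ball x e" for y a
  proof -
    have "r * norm a \<le> (\<Sum>i\<in>I. \<bar>a \<bullet> W i x\<bar>)"
      using norm_le_sum_abs_inner[OF I _ r(2)] r by simp
    also have "\<dots> \<le> (\<Sum>i\<in>I. \<bar>a \<bullet> W i y\<bar> + norm a * norm (W i y - W i x))"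
    proof (rule sum_mono)
      fix i
      show "\<bar>a \<bullet> W i x\<bar> \<le> \<bar>a \<bullet> W i y\<bar> + norm a * norm (W i y - W i x)"
        using Cauchy_Schwarz_ineq2[of a "W i y - W i x"] by (simp add: inner_diff_right)
    qed
    also have "\<dots> = (\<Sum>i\<in>I. \<bar>a \<bullet> W i y\<bar>) + norm a * D y"
      by (simp add: sum.distrib D_def sum_distrib_left)
    also have "norm a * D y \<le> norm a * (r / 2)"
      using e(2)[of y] y by (intro mult_left_mono) (auto simp: dist_commute less_imp_le)
    finally show ?thesis by (simp add: field_simps)
  qed
  then show ?thesis using r e by (intro exI[of _ "r / 2"] exI[of _ e] conjI) auto
qed

text \<open>Subtracting the representations at \<open>y\<close> and \<open>x\<close> gives \<open>(q
  y - q x) \<bullet> W i y = p i y - p i x - q x \<bullet> (W i y - W i x)\<close>. The right side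
  contains \<open>q\<close> only at the fixed point \<open>x\<close>, so it tends to 0 without any
  prior control of \<open>q\<close>, and the local lower bound passes this on to
  \<open>q y - q x\<close>.\<close>

lemma isCont_inner_coefficient:
  fixes W :: "'i \<Rightarrow> 'x::real_normed_vector \<Rightarrow> 'a::real_inner"
  assumes U: "open U" "x \<in> U" and I: "finite I"
    and int: "0 \<in> interior (convex hull ((\<lambda>i. W i x) ` I))"
    and W: "\<And>i. i \<in> I \<Longrightarrow> isCont (W i) x" and p: "\<And>i. i \<in> I \<Longrightarrow> isCont (p i) x"
    and eq: "\<And>i y. i \<in> I \<Longrightarrow> y \<in> U \<Longrightarrow> p i y = q y \<bullet> W i y"
  shows "isCont q x"
proof -
  obtain c e where c: "c > 0" "e > 0" "\<And>y a. y \<in> ball x e \<Longrightarrow> c * norm a \<le> (\<Sum>i\<in>I. \<bar>a \<bullet> W i y\<bar>)"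
    using norm_le_sum_abs_inner_locally[OF I int W] by blast
  define E where "E y = (\<Sum>i\<in>I. \<bar>p i y - p i x - q x \<bullet> (W i y - W i x)\<bar>) / c" for y
  have "isCont E x" unfolding E_def using W p c by (intro continuous_intros) auto
  then have E: "(E \<longlongrightarrow> 0) (at x)" by (simp add: isCont_def E_def)
  have "eventually (\<lambda>y. y \<in> U \<inter> ball x e) (at x)"
    using U c by (intro eventually_at_in_open') auto
  then have "eventually (\<lambda>y. norm (q y - q x) \<le> E y) (at x)"
  proof eventually_elim
    case (elim y)
    have "c * norm (q y - q x) \<le> (\<Sum>i\<in>I. \<bar>(q y - q x) \<bullet> W i y\<bar>)" using c elim by blast
    also have "\<dots> = (\<Sum>i\<in>I. \<bar>p i y - p i x - q x \<bullet> (W i y - W i x)\<bar>)"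
      using elim U by (intro sum.cong refl) (simp add: eq inner_diff_left inner_diff_right)
    finally show ?case using c by (simp add: E_def field_simps)
  qed
  then have "((\<lambda>y. q y - q x) \<longlongrightarrow> 0) (at x)" using E by (rule Lim_null_comparison)
  then show ?thesis by (simp add: isCont_def LIM_zero_iff)
qed

lemma locally_lipschitz_on_finite:
  assumes "finite I" and "\<And>i. i \<in> I \<Longrightarrow> locally_lipschitz_on U (f i)" and "x \<in> U"
  shows "\<exists>e>0. \<exists>L. \<forall>i\<in>I. L-lipschitz_on (ball x e \<inter> U) (f i)"
  using assms(1,2)
proof (induction I)
  case empty
  show ?case by (auto intro: exI[of _ "1::real"])
next
  case (insert j I)
  obtain e L where e: "e > 0" "\<And>i. i \<in> I \<Longrightarrow> L-lipschitz_on (ball x e \<inter> U) (f i)"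
    using insert by blast
  obtain e' L' where e': "e' > 0" "L'-lipschitz_on (ball x e' \<inter> U) (f j)"
    using insert.prems[of j] \<open>x \<in> U\<close> by (auto simp: locally_lipschitz_on_def)
  have "(max L L')-lipschitz_on (ball x (min e e') \<inter> U) (f i)" if "i \<in> insert j I" for i
    using that
  proof
    assume "i = j"
    then show ?thesis by (auto intro!: lipschitz_on_mono[OF e'(2)])
  next
    assume "i \<in> I"
    then show ?thesis by (auto intro!: lipschitz_on_mono[OF e(2)])
  qed
  then show ?case using e(1) e'(1) by (intro exI[of _ "min e e'"] exI[of _ "max L L'"] conjI) auto
qed

lemma locally_lipschitz_on_imp_isCont:
  assumes "open U" "locally_lipschitz_on U f" "x \<in> U"
  shows "isCont f x"
proof -
  obtain e L where "e > 0" "L-lipschitz_on (ball x e \<inter> U) f"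
    using assms by (auto simp: locally_lipschitz_on_def)
  then show ?thesis
    using assms continuous_on_eq_continuous_at[of "ball x e \<inter> U" f] lipschitz_on_continuous_on[of L _ f]
    by (auto simp: open_Int)
qed

text \<open>The same identity is used with two moving points \<open>y\<close> and \<open>z\<close>.
  The factor \<open>q z\<close> now varies, so \<open>q\<close> is first bounded near
  \<open>x\<close>, by applying the lower bound to \<open>a = q y\<close>.\<close>

lemma locally_lipschitz_on_inner_coefficient:
  fixes W :: "'i \<Rightarrow> 'x::real_normed_vector \<Rightarrow> 'a::real_inner"
  assumes U: "open U" "x \<in> U" and I: "finite I"
    and int: "0 \<in> interior (convex hull ((\<lambda>i. W i x) ` I))"
    and W: "\<And>i. i \<in> I \<Longrightarrow> locally_lipschitz_on U (W i)"
    and p: "\<And>i. i \<in> I \<Longrightarrow> locally_lipschitz_on U (p i)"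
    and eq: "\<And>i y. i \<in> I \<Longrightarrow> y \<in> U \<Longrightarrow> p i y = q y \<bullet> W i y"
  shows "\<exists>e>0. \<exists>L. L-lipschitz_on (ball x e \<inter> U) q"
proof -
  have "isCont (W i) x" if "i \<in> I" for i
    using locally_lipschitz_on_imp_isCont[OF U(1) W[OF that] U(2)] .
  from norm_le_sum_abs_inner_locally[OF I int this]
  obtain c e where c: "c > 0" "e > 0" "\<And>y a. y \<in> ball x e \<Longrightarrow> c * norm a \<le> (\<Sum>i\<in>I. \<bar>a \<bullet> W i y\<bar>)"
    by blast
  obtain eW LW where LW: "eW > 0" "\<And>i. i \<in> I \<Longrightarrow> LW-lipschitz_on (ball x eW \<inter> U) (W i)"
    using locally_lipschitz_on_finite[of I U W, OF I W U(2)] by blast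
  obtain ep Lp where Lp: "ep > 0" "\<And>i. i \<in> I \<Longrightarrow> Lp-lipschitz_on (ball x ep \<inter> U) (p i)"
    using locally_lipschitz_on_finite[of I U p, OF I p U(2)] by blast
  define d where "d = min e (min eW ep)"
  define N where "N = ball x d \<inter> U"
  have d: "d > 0" "d \<le> e" "d \<le> eW" "d \<le> ep" using c LW Lp by (auto simp: d_def)
  have lipW: "norm (W i y - W i z) \<le> \<bar>LW\<bar> * norm (y - z)" if "i \<in> I" "y \<in> N" "z \<in> N" for i y z
    using lipschitz_on_normD[OF LW(2)[OF that(1)], of y z] that d
    by (auto simp: N_def intro: order_trans[OF _ mult_right_mono[OF abs_ge_self]])
  have lipp: "\<bar>p i y - p i z\<bar> \<le> \<bar>Lp\<bar> * norm (y - z)" if "i \<in> I" "y \<in> N" "z \<in> N" for i y z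
    using lipschitz_on_normD[OF Lp(2)[OF that(1)], of y z] that d
    by (auto simp: N_def intro: order_trans[OF _ mult_right_mono[OF abs_ge_self]])
  \<comment> \<open>On \<open>N\<close>, within distance \<open>d\<close> of \<open>x\<close>, each
    \<open>p i\<close> deviates from \<open>p i x\<close> by at most
    \<open>\<bar>Lp\<bar> * d\<close>. The absolute values keep \<open>B\<close> non-negative even
    for empty \<open>I\<close>, where the sign of \<open>Lp\<close> is unknown.\<close>
  define B where "B = (\<Sum>i\<in>I. \<bar>p i x\<bar> + \<bar>Lp\<bar> * d) / c"
  have "B \<ge> 0" using c d by (auto simp: B_def intro!: divide_nonneg_nonneg sum_nonneg)
  have bound: "norm (q y) \<le> B" if y: "y \<in> N" for y
  proof -
    have "c * norm (q y) \<le> (\<Sum>i\<in>I. \<bar>q y \<bullet> W i y\<bar>)" using c(3) y d by (auto simp: N_def)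
    also have "\<dots> \<le> (\<Sum>i\<in>I. \<bar>p i x\<bar> + \<bar>Lp\<bar> * d)"
    proof (rule sum_mono)
      fix i assume i: "i \<in> I"
      have "\<bar>p i y - p i x\<bar> \<le> \<bar>Lp\<bar> * norm (y - x)" using i y U d by (intro lipp) (auto simp: N_def)
      also have "\<dots> \<le> \<bar>Lp\<bar> * d"
        using y by (intro mult_left_mono) (auto simp: N_def dist_norm norm_minus_commute)
      finally show "\<bar>q y \<bullet> W i y\<bar> \<le> \<bar>p i x\<bar> + \<bar>Lp\<bar> * d"
        using eq[OF i, of y] y by (auto simp: N_def)
    qed
    finally show ?thesis using c by (simp add: B_def field_simps)
  qed
  \<comment> \<open>Per index, \<open>\<bar>Lp\<bar>\<close> accounts for the increment of
    \<open>p i\<close>, and \<open>B * \<bar>LW\<bar>\<close> for that of \<open>W i\<close>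
    multiplied by the bounded factor \<open>q z\<close>.\<close>
  define L where "L = (\<Sum>i\<in>I. \<bar>Lp\<bar> + B * \<bar>LW\<bar>) / c"
  have "L-lipschitz_on N q"
  proof (rule lipschitz_onI)
    show "L \<ge> 0" using c \<open>B \<ge> 0\<close> by (auto simp: L_def intro!: divide_nonneg_nonneg sum_nonneg)
    fix y z assume y: "y \<in> N" and z: "z \<in> N"
    have "c * norm (q y - q z) \<le> (\<Sum>i\<in>I. \<bar>(q y - q z) \<bullet> W i y\<bar>)" using c(3) y d by (auto simp: N_def)
    also have "\<dots> \<le> (\<Sum>i\<in>I. (\<bar>Lp\<bar> + B * \<bar>LW\<bar>) * norm (y - z))"
    proof (rule sum_mono)
      fix i assume i: "i \<in> I"
      have "(q y - q z) \<bullet> W i y = (p i y - p i z) - q z \<bullet> (W i y - W i z)"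
        using eq[OF i] y z by (auto simp: N_def inner_diff_left inner_diff_right)
      then have "\<bar>(q y - q z) \<bullet> W i y\<bar> \<le> \<bar>p i y - p i z\<bar> + \<bar>q z \<bullet> (W i y - W i z)\<bar>" by linarith
      also have "\<bar>q z \<bullet> (W i y - W i z)\<bar> \<le> norm (q z) * norm (W i y - W i z)"
        by (rule Cauchy_Schwarz_ineq2)
      also have "\<dots> \<le> B * (\<bar>LW\<bar> * norm (y - z))"
        using bound[OF z] lipW[OF i y z] \<open>B \<ge> 0\<close> by (intro mult_mono) auto
      finally show "\<bar>(q y - q z) \<bullet> W i y\<bar> \<le> (\<bar>Lp\<bar> + B * \<bar>LW\<bar>) * norm (y - z)"
        using lipp[OF i y z] by (simp add: algebra_simps)
    qed
    also have "\<dots> = c * (L * norm (y - z))"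
      using c by (simp add: L_def)
    finally show "dist (q y) (q z) \<le> L * dist y z" using c by (simp add: dist_norm)
  qed
  then show ?thesis using d(1) unfolding N_def by blast
qed

section \<open>Local Lipschitz continuity and partial derivatives\<close>

text \<open>A continuous derivative is bounded near each point, and the mean value inequality
  applies on a ball inside \<open>U\<close>, which is convex although \<open>U\<close> need not
  be.\<close>

lemma cont_differentiable_on_imp_locally_lipschitz_on:
  fixes f :: "'a::real_normed_vector \<Rightarrow> 'b::real_normed_vector"
  assumes U: "open U" and f: "cont_differentiable_on U f"
  shows "locally_lipschitz_on U f"
  unfolding locally_lipschitz_on_def
proof
  fix x assume x: "x \<in> U"
  obtain f' where f': "\<And>y. y \<in> U \<Longrightarrow> (f has_derivative blinfun_apply (f' y)) (at y)"
    and cont: "continuous_on U f'"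
    using f by (auto simp: cont_differentiable_on_def)
  have "isCont f' x" using cont U x continuous_on_eq_continuous_at by blast
  then obtain d where d: "d > 0" "\<And>y. dist y x < d \<Longrightarrow> dist (f' y) (f' x) < 1"
    unfolding continuous_at_eps_delta using zero_less_one by blast
  obtain e' where e': "e' > 0" "ball x e' \<subseteq> U" using U x openE by blast
  define e where "e = min d e'"
  \<comment> \<open>The summand 1 is the tolerance used to choose \<open>d\<close>.\<close>
  define L where "L = norm (f' x) + 1"
  have e: "e > 0" "ball x e \<subseteq> U" "e \<le> d" using d e' by (auto simp: e_def)
  have "norm (f y - f z) \<le> L * norm (y - z)" if "y \<in> ball x e" "z \<in> ball x e" for y z
  proof (rule differentiable_bound[where S = "ball x e" and f' = "\<lambda>y. blinfun_apply (f' y)"])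
    fix u assume u: "u \<in> ball x e"
    show "(f has_derivative blinfun_apply (f' u)) (at u within ball x e)"
      using f' u e by (blast intro: has_derivative_at_withinI)
    have "dist (f' u) (f' x) < 1" using d(2)[of u] u e by (auto simp: dist_commute)
    then have "norm (f' u) \<le> L"
      using norm_triangle_ineq2[of "f' u" "f' x"] by (simp add: L_def dist_norm)
    then show "onorm (blinfun_apply (f' u)) \<le> L" by (simp add: norm_blinfun.rep_eq)
  qed (use that in auto)
  then have "L-lipschitz_on (ball x e) f" by (intro lipschitz_onI) (auto simp: dist_norm L_def)
  then have "L-lipschitz_on (ball x e \<inter> U) f" by (rule lipschitz_on_subset) simp
  then show "\<exists>e>0. \<exists>L. L-lipschitz_on (ball x e \<inter> U) f" using e(1) by blast
qed

text \<open>Chain rule along the coordinate line; it also guarantees that \<open>deriv\<close> is a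
  genuine derivative here.\<close>

lemma partial_deriv_eq:
  fixes f :: "real ^ 'k::finite \<Rightarrow> real"
  assumes "(f has_derivative f') (at x)"
  shows "partial_deriv l f x = f' (axis l 1)"
proof -
  have "((\<lambda>t. x + t *\<^sub>R axis l 1) has_derivative (\<lambda>t. t *\<^sub>R axis l 1)) (at (0::real))"
    by (auto intro!: derivative_eq_intros)
  from has_derivative_compose[OF this, of f f'] assms
  have "((\<lambda>t. f (x + t *\<^sub>R axis l 1)) has_derivative (\<lambda>t. f' (t *\<^sub>R axis l 1))) (at 0)" by simp
  moreover have "f' (t *\<^sub>R axis l 1) = f' (axis l 1) * t" for t
    using has_derivative_bounded_linear[OF assms]
    by (simp add: linear_simps)
  ultimately show ?thesis
    unfolding partial_deriv_def
    by (intro DERIV_imp_deriv) (simp add: has_field_derivative_def)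
qed

text \<open>Meant for expected scores of mixtures: their affine identity is available on
  \<open>A\<close> only, so equality on an open set around \<open>x\<close> has to suffice. It also
  yields the differentiability of \<open>h\<close> at \<open>x\<close>.\<close>

lemma partial_deriv_locally_eq_affine:
  fixes f g h :: "real ^ 'k::finite \<Rightarrow> real"
  assumes U: "open U" "x \<in> U" and diff: "f differentiable (at x)" "g differentiable (at x)"
    and eq: "\<And>z. z \<in> U \<Longrightarrow> h z = a * f z + b * g z"
  shows "partial_deriv l h x = a * partial_deriv l f x + b * partial_deriv l g x"
proof -
  obtain f' g' where f': "(f has_derivative f') (at x)" and g': "(g has_derivative g') (at x)"
    using diff by (auto simp: differentiable_def)
  have "((\<lambda>z. a * f z + b * g z) has_derivative (\<lambda>v. a * f' v + b * g' v)) (at x)"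
    using f' g' by (auto intro!: derivative_eq_intros)
  then have "(h has_derivative (\<lambda>v. a * f' v + b * g' v)) (at x)"
    by (rule has_derivative_transform_within_open[OF _ U]) (simp add: eq)
  then show ?thesis by (simp add: partial_deriv_eq[OF f'] partial_deriv_eq[OF g'] partial_deriv_eq)
qed

text \<open>The Euclidean distance is at most the sum of the coordinate distances, so the constants
  add up.\<close>

lemma lipschitz_on_vec:
  fixes f :: "'x::metric_space \<Rightarrow> 'b::real_normed_vector ^ 'n::finite"
  assumes "\<And>i. (L i)-lipschitz_on X (\<lambda>x. f x $ i)"
  shows "(\<Sum>i\<in>UNIV. L i)-lipschitz_on X f"
proof (rule lipschitz_onI)
  show "0 \<le> (\<Sum>i\<in>UNIV. L i)" using assms lipschitz_on_nonneg by (blast intro: sum_nonneg)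
  fix x y assume "x \<in> X" "y \<in> X"
  have "dist (f x) (f y) \<le> (\<Sum>i\<in>UNIV. dist (f x $ i) (f y $ i))"
    unfolding dist_vec_def by (rule L2_set_le_sum) simp
  also have "\<dots> \<le> (\<Sum>i\<in>UNIV. L i * dist x y)"
    using \<open>x \<in> X\<close> \<open>y \<in> X\<close> by (intro sum_mono lipschitz_onD[OF assms])
  finally show "dist (f x) (f y) \<le> (\<Sum>i\<in>UNIV. L i) * dist x y" by (simp add: sum_distrib_right)
qed

lemma locally_lipschitz_on_vec:
  fixes f :: "'x::metric_space \<Rightarrow> 'b::real_normed_vector ^ 'n::finite"
  assumes "\<And>i. locally_lipschitz_on U (\<lambda>x. f x $ i)"
  shows "locally_lipschitz_on U f"
  unfolding locally_lipschitz_on_def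
proof
  fix x assume "x \<in> U"
  from locally_lipschitz_on_finite[of UNIV U "\<lambda>i x. f x $ i", OF finite assms this]
  obtain e L where e: "e > 0" and L: "\<And>i. L-lipschitz_on (ball x e \<inter> U) (\<lambda>x. f x $ i)" by blast
  show "\<exists>e>0. \<exists>L. L-lipschitz_on (ball x e \<inter> U) f" using lipschitz_on_vec[OF L] e by blast
qed

lemma locally_lipschitz_partial_deriv:
  fixes f :: "real ^ 'k::finite \<Rightarrow> real"
  assumes "locally_lipschitz_gradient_on U f"
  shows "locally_lipschitz_on U (partial_deriv l f)"
proof -
  obtain g where g: "\<And>x. x \<in> U \<Longrightarrow> GDERIV f x :> g x" and lip: "locally_lipschitz_on U g"
    using assms by (auto simp: locally_lipschitz_gradient_on_def)
  have eq: "partial_deriv l f x = g x $ l" if "x \<in> U" for x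
    using partial_deriv_eq[of f "\<lambda>v. v \<bullet> g x" x l] g[OF that]
    by (simp add: gderiv_def inner_axis')
  show ?thesis
    unfolding locally_lipschitz_on_def
  proof
    fix x assume "x \<in> U"
    then obtain e L where eL: "e > 0" "L-lipschitz_on (ball x e \<inter> U) g"
      using lip by (auto simp: locally_lipschitz_on_def)
    have "L-lipschitz_on (ball x e \<inter> U) (partial_deriv l f)"
    proof (rule lipschitz_onI)
      fix y z assume yz: "y \<in> ball x e \<inter> U" "z \<in> ball x e \<inter> U"
      have "dist (g y $ l) (g z $ l) \<le> dist (g y) (g z)" by (rule dist_vec_nth_le)
      also have "\<dots> \<le> L * dist y z" using lipschitz_onD[OF eL(2)] yz by blast
      finally show "dist (partial_deriv l f y) (partial_deriv l f z) \<le> L * dist y z"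
        using eq yz by simp
    qed (use eL lipschitz_on_nonneg in blast)
    then show "\<exists>e>0. \<exists>L. L-lipschitz_on (ball x e \<inter> U) (partial_deriv l f)" using eL by blast
  qed
qed

lemma isCont_partial_deriv:
  fixes f :: "real ^ 'k::finite \<Rightarrow> real"
  assumes "open U" "cont_differentiable_on U f" "x \<in> U"
  shows "isCont (partial_deriv l f) x"
proof -
  obtain f' where f': "\<And>y. y \<in> U \<Longrightarrow> (f has_derivative blinfun_apply (f' y)) (at y)"
    and cont: "continuous_on U f'"
    using assms by (auto simp: cont_differentiable_on_def)
  have "continuous_on U (\<lambda>y. f' y (axis l 1))" using cont by (intro continuous_intros)
  then have "continuous_on U (partial_deriv l f)"
    by (rule continuous_on_eq) (simp add: partial_deriv_eq[OF f'])
  then show ?thesis using assms continuous_on_eq_continuous_at by blast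
qed

section \<open>Representing the gradient of the expected score by the identification
  function\<close>

theorem theorem3p2:
  fixes \<O> :: "(real ^ 'd) set"
    and A :: "(real ^ 'k) set"
    and \<F> :: "(real ^ 'd) measure set"
    and T :: "(real ^ 'd) measure \<Rightarrow> real ^ 'k"
    and V :: "real ^ 'k \<Rightarrow> real ^ 'd \<Rightarrow> real ^ 'k"
    and S :: "real ^ 'k \<Rightarrow> real ^ 'd \<Rightarrow> real"
  assumes "\<F> \<subseteq> borel_prob_measures \<O>"
    and "convex_class \<F>"
    and "T ` \<F> = A"
    and "strict_identification A \<F> T V"
    and "strictly_consistent A \<F> T S"
    and "\<forall>x\<in>interior A. \<exists>F :: nat \<Rightarrow> (real ^ 'd) measure.
           (\<forall>i\<in>{1..CARD('k) + 1}. F i \<in> \<F>) \<and>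
           0 \<in> interior (convex hull ((\<lambda>i. expect V x (F i)) ` {1..CARD('k) + 1}))"
    and "\<forall>F\<in>\<F>. cont_differentiable_on (interior A) (\<lambda>x. expect S x F)"
  shows "\<exists>h :: real ^ 'k \<Rightarrow> real ^ 'k ^ 'k.
    (\<forall>l. \<forall>x\<in>interior A. \<forall>F\<in>\<F>.
       partial_deriv l (\<lambda>z. expect S z F) x = (\<Sum>m\<in>UNIV. h x $ l $ m * expect V x F $ m)) \<and>
    ((\<forall>F\<in>\<F>. continuous_on A (\<lambda>x. expect V x F)) \<longrightarrow>
       continuous_on (interior A) h) \<and>
    ((\<forall>F\<in>\<F>. cont_differentiable_on (interior A) (\<lambda>x. expect V x F)) \<and>
     (\<forall>F\<in>\<F>. locally_lipschitz_gradient_on (interior A) (\<lambda>x. expect S x F) \<and>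
        (T F \<in> interior A \<longrightarrow> twice_cont_differentiable_at (\<lambda>x. expect S x F) (T F))) \<longrightarrow>
       locally_lipschitz_on (interior A) h)"
proof -
  define U where "U = interior A"
  have U: "open U" "U \<subseteq> A" by (auto simp: U_def interior_subset)
  have meas: "finite_measure F" "sets F = sets (restrict_space borel \<O>)" if "F \<in> \<F>" for F
    using assms(1) that by (auto simp: borel_prob_measures_def prob_space.finite_measure)
  have intV: "integrable F (V x)" and intS: "integrable F (S x)" if "x \<in> A" "F \<in> \<F>" for x F
    using assms(4,5) that
    by (auto simp: strict_identification_def strictly_consistent_def class_integrable_def)
  have C1: "cont_differentiable_on U (\<lambda>x. expect S x F)" if "F \<in> \<F>" for F
    using assms(7) that by (simp add: U_def)
  then have deriv: "(\<lambda>z. expect S z F) differentiable (at x)" if "F \<in> \<F>" "x \<in> U" for F x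
    using that by (fastforce simp: cont_differentiable_on_def differentiable_def)
  \<comment> \<open>One \<open>H\<close> serves all \<open>x\<close> at once, so the identity for
    the expected score can be differentiated in \<open>x\<close>.\<close>
  have mixture: "\<exists>H\<in>\<F>. (\<forall>x\<in>A. expect V x H = (1 - t) *\<^sub>R expect V x F + t *\<^sub>R expect V x G) \<and>
      (\<forall>x\<in>A. expect S x H = (1 - t) * expect S x F + t * expect S x G)"
    if F: "F \<in> \<F>" and G: "G \<in> \<F>" and t: "0 \<le> t" "t \<le> 1" for F G t
  proof -
    obtain H where H: "H \<in> \<F>"
      and mix: "\<And>B. B \<in> sets F \<Longrightarrow> measure H B = (1 - t) * measure F B + t * measure G B"
      using assms(2) F G t unfolding convex_class_def by (meson atLeastAtMost_iff)
    note [simp] = meas(2)[OF F] meas(2)[OF G] meas(2)[OF H]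
    note int = integral_mixture[OF meas(1)[OF F] meas(1)[OF G] meas(1)[OF H] _ _ t mix]
    have "expect V x H = (1 - t) *\<^sub>R expect V x F + t *\<^sub>R expect V x G"
      "expect S x H = (1 - t) * expect S x F + t * expect S x G" if "x \<in> A" for x
      unfolding expect_def
      using int[of "V x"] int[of "S x"] intV[OF that] intS[OF that] F G H by auto
    then show ?thesis using H by blast
  qed

  \<comment> \<open>Strict identification turns \<open>expect V x F = 0\<close> into
    \<open>T F = x\<close>. Consistency makes \<open>x\<close> a minimiser of the expected score,
    and at an interior minimum the derivative vanishes.\<close>
  have critical: "partial_deriv l (\<lambda>z. expect S z F) x = 0"
    if x: "x \<in> U" and F: "F \<in> \<F>" and V0: "expect V x F = 0" for l x F
  proof -
    have "T F = x" using V0 assms(4) x F U by (auto simp: strict_identification_def)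
    then have min: "\<forall>y\<in>U. expect S x F \<le> expect S y F"
      using assms(5) F U by (auto simp: strictly_consistent_def)
    obtain f' where f': "((\<lambda>z. expect S z F) has_derivative f') (at x)"
      using deriv[OF F x] by (auto simp: differentiable_def)
    have "f' = (\<lambda>v. 0)" using differential_zero_maxmin[OF x U(1) f'] min by blast
    then show ?thesis using partial_deriv_eq[OF f'] by simp
  qed

  have span: "\<exists>I F. finite (I :: nat set) \<and> (\<forall>i\<in>I. F i \<in> \<F>) \<and>
      0 \<in> interior (convex hull ((\<lambda>i. expect V x (F i)) ` I))" if "x \<in> U" for x
    using assms(6) that unfolding U_def by (metis finite_atLeastAtMost)

  have "\<exists>q. \<forall>F\<in>\<F>. partial_deriv l (\<lambda>z. expect S z F) x = q \<bullet> expect V x F" if x: "x \<in> U" for l x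
  proof -
    \<comment> \<open>\<open>C\<close> pairs the two quantities over all of \<open>\<F>\<close>. It
      is convex by \<open>mixture\<close>, \<open>critical\<close> gives \<open>s = 0\<close> over
      0, and assumption (a) makes 0 interior to its projection; hence it lies on the graph of a
      linear function.\<close>
    define C where "C = (\<lambda>F. (expect V x F, partial_deriv l (\<lambda>z. expect S z F) x)) ` \<F>"
    have "convex C"
      unfolding convex_alt
    proof (intro ballI allI impI)
      fix u v :: "(real ^ 'k) \<times> real" and t :: real
      assume "u \<in> C" "v \<in> C" and t: "0 \<le> t \<and> t \<le> 1"
      then obtain F G where F: "F \<in> \<F>" "u = (expect V x F, partial_deriv l (\<lambda>z. expect S z F) x)"
        and G: "G \<in> \<F>" "v = (expect V x G, partial_deriv l (\<lambda>z. expect S z G) x)"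
        by (auto simp: C_def)
      obtain H where H: "H \<in> \<F>"
        "\<forall>y\<in>A. expect V y H = (1 - t) *\<^sub>R expect V y F + t *\<^sub>R expect V y G"
        "\<forall>y\<in>A. expect S y H = (1 - t) * expect S y F + t * expect S y G"
        using mixture[OF F(1) G(1)] t by blast
      have "partial_deriv l (\<lambda>z. expect S z H) x =
          (1 - t) * partial_deriv l (\<lambda>z. expect S z F) x + t * partial_deriv l (\<lambda>z. expect S z G) x"
        using H(3) U by (intro partial_deriv_locally_eq_affine[OF U(1) x deriv[OF F(1) x] deriv[OF G(1) x]]) auto
      then have "(1 - t) *\<^sub>R u + t *\<^sub>R v = (expect V x H, partial_deriv l (\<lambda>z. expect S z H) x)"
        using H(2) x U by (auto simp: F G)
      then show "(1 - t) *\<^sub>R u + t *\<^sub>R v \<in> C" using H(1) by (auto simp: C_def)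
    qed
    moreover have "s = 0" if "(0, s) \<in> C" for s
      using that critical[OF x] by (auto simp: C_def)
    moreover have "0 \<in> interior (fst ` C)"
    proof -
      obtain I :: "nat set" and F where IF: "\<forall>i\<in>I. F i \<in> \<F>"
        "0 \<in> interior (convex hull ((\<lambda>i. expect V x (F i)) ` I))" using span[OF x] by blast
      have "convex (fst ` C)" using \<open>convex C\<close> by (intro convex_linear_image linear_fst)
      then have "convex hull ((\<lambda>i. expect V x (F i)) ` I) \<subseteq> fst ` C"
        using IF(1) by (intro hull_minimal) (auto simp: C_def image_image)
      then show ?thesis using IF(2) interior_mono by blast
    qed
    ultimately obtain q where "\<forall>(w, s)\<in>C. s = q \<bullet> w"
      using convex_graph_imp_linear by blast
    then show ?thesis by (auto simp: C_def)
  qed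
  \<comment> \<open>The condition \<open>x \<in> U\<close> moves under the existential quantifier so
    that choice gives a function of all \<open>l\<close> and \<open>x\<close>; outside
    \<open>U\<close> its values are arbitrary.\<close>
  then have "\<forall>l x. \<exists>q. x \<in> U \<longrightarrow>
      (\<forall>F\<in>\<F>. partial_deriv l (\<lambda>z. expect S z F) x = q \<bullet> expect V x F)"
    by blast
  then obtain q where "\<forall>l x. x \<in> U \<longrightarrow>
      (\<forall>F\<in>\<F>. partial_deriv l (\<lambda>z. expect S z F) x = q l x \<bullet> expect V x F)"
    unfolding choice_iff by blast
  then have q: "partial_deriv l (\<lambda>z. expect S z F) x = q l x \<bullet> expect V x F"
    if "x \<in> U" "F \<in> \<F>" for l x F
    using that by blast
  \<comment> \<open>The vector \<open>q l x\<close> becomes row \<open>l\<close> of the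
    matrix.\<close>
  define h :: "real ^ 'k \<Rightarrow> real ^ 'k ^ 'k" where "h x = (\<chi> l. q l x)" for x

  have "continuous_on U h" if V: "\<forall>F\<in>\<F>. continuous_on A (\<lambda>x. expect V x F)"
  proof -
    have contV: "isCont (\<lambda>x. expect V x F) x" if "F \<in> \<F>" "x \<in> U" for F x
      using V that U continuous_on_subset continuous_on_eq_continuous_at by blast
    \<comment> \<open>\<open>q\<close> was chosen pointwise, yet its regularity is automatic: the
      values at the finitely many distributions for \<open>x\<close> control it on a whole
      neighbourhood.\<close>
    have "isCont (q l) x" if x: "x \<in> U" for l x
    proof -
      obtain I :: "nat set" and F where IF: "finite I" "\<forall>i\<in>I. F i \<in> \<F>"
        "0 \<in> interior (convex hull ((\<lambda>i. expect V x (F i)) ` I))" using span[OF x] by blast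
      show ?thesis
      proof (rule isCont_inner_coefficient[where W = "\<lambda>i x. expect V x (F i)",
            OF U(1) x IF(1,3)])
        fix i assume i: "i \<in> I"
        show "isCont (\<lambda>x. expect V x (F i)) x"
          using contV IF(2) i x by blast
        show "isCont (partial_deriv l (\<lambda>z. expect S z (F i))) x"
          using isCont_partial_deriv[OF U(1) C1 x] IF(2) i by blast
        show "partial_deriv l (\<lambda>z. expect S z (F i)) y = q l y \<bullet> expect V y (F i)" if "y \<in> U" for y
          using q that IF(2) i by blast
      qed
    qed
    then have "continuous_on U (q l)" for l using continuous_at_imp_continuous_on by blast
    then show ?thesis unfolding h_def by (intro continuous_on_vec_lambda)
  qed

  moreover have "locally_lipschitz_on U h"
    if V: "\<forall>F\<in>\<F>. cont_differentiable_on U (\<lambda>x. expect V x F)"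
      and S: "\<forall>F\<in>\<F>. locally_lipschitz_gradient_on U (\<lambda>x. expect S x F)"
  proof (rule locally_lipschitz_on_vec)
    fix l
    show "locally_lipschitz_on U (\<lambda>x. h x $ l)"
      unfolding locally_lipschitz_on_def
    proof
      fix x assume x: "x \<in> U"
      obtain I :: "nat set" and F where IF: "finite I" "\<forall>i\<in>I. F i \<in> \<F>"
        "0 \<in> interior (convex hull ((\<lambda>i. expect V x (F i)) ` I))" using span[OF x] by blast
      have "\<exists>e>0. \<exists>L. L-lipschitz_on (ball x e \<inter> U) (q l)"
      \<comment> \<open>The distributions \<open>F i\<close> are those selected at \<open>x\<close>
        and stay fixed while the point varies near \<open>x\<close>.\<close>
      proof (rule locally_lipschitz_on_inner_coefficient[where W = "\<lambda>i x. expect V x (F i)",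
            OF U(1) x IF(1,3)])
        fix i assume i: "i \<in> I"
        show "locally_lipschitz_on U (\<lambda>x. expect V x (F i))"
          using cont_differentiable_on_imp_locally_lipschitz_on[OF U(1)] V IF(2) i by blast
        show "locally_lipschitz_on U (partial_deriv l (\<lambda>z. expect S z (F i)))"
          using locally_lipschitz_partial_deriv S IF(2) i by blast
        show "partial_deriv l (\<lambda>z. expect S z (F i)) y = q l y \<bullet> expect V y (F i)" if "y \<in> U" for y
          using q that IF(2) i by blast
      qed
      then show "\<exists>e>0. \<exists>L. L-lipschitz_on (ball x e \<inter> U) (\<lambda>x. h x $ l)" by (simp add: h_def)
    qed
  qed

  moreover have "partial_deriv l (\<lambda>z. expect S z F) x = (\<Sum>m\<in>UNIV. h x $ l $ m * expect V x F $ m)"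
    if "x \<in> U" "F \<in> \<F>" for l x F
    using q[OF that] by (simp add: h_def inner_vec_def)

  ultimately show ?thesis unfolding U_def by blast
qed

end
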